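(* Let $X$ be a curve of genus $g\ge 1$ defined over $\mathbb{F}_q$, let $\alpha_1,\ldots,\alpha_g$ be the real parts of its Frobenius eigenvalues, and let $\delta_{HP}(X)$ be its HP-defect. Then: (i) $\displaystyle \delta_{HP}(X)=4\left(g\sum_{j=1}^g\alpha_j^2-\left(\sum_{j=1}^g\alpha_j\right)^2\right)$. (ii) Setting $\sigma_1=\sum_{j=1}^g\alpha_j$ and $\sigma_2=\sum_{1\le j<k\le g}\alpha_j\alpha_k$, one has $\delta_{HP}(X)=4\left((g-1)\sigma_1^2-2g\sigma_2\right)$. (iii) $\displaystyle \delta_{HP}(X)=4\sum_{1\le j<k\le g}(\alpha_j-\alpha_k)^2$. (iv) Setting $\overline{\alpha}:=\frac1g\sum_{j=1}^g\alpha_j$ and $V(\alpha):=\frac1g\sum_{j=1}^g(\alpha_j-\overline{\alpha})^2$ (the mean and the variance of the sample $(\alpha_j)_{1\le j\le g}$), one has $\delta_{HP}(X)=4g^2V(\alpha)$.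
   Context: $q$ is a power of a prime. A curve over $\mathbb{F}_q$ means an absolutely irreducible smooth projective algebraic curve defined over $\mathbb{F}_q$. For a curve $X$ over $\mathbb{F}_q$ of genus $g\ge 1$, the zeta function is $\exp\left(\sum_{n\ge1}\sharp X(\mathbb{F}_{q^n})\frac{T^n}{n}\right)=\frac{L_X(T)}{(1-T)(1-qT)}$, where the $L$-polynomial $L_X(T)\in\mathbb{Z}[T]$ has degree $2g$ and can be written $L_X(T)=\prod_{j=1}^g(1-\omega_jT)(1-\overline{\omega}_jT)$ with $|\omega_j|=\sqrt q$. The $\omega_j,\overline{\omega}_j$ are called the Frobenius eigenvalues of $X$, and $\alpha_j$ denotes the real part of $\omega_j$ ($1\le j\le g$). The HP-defect of $X$ is $\delta_{HP}(X)=2qg^2-\left(\sharp X(\mathbb{F}_q)-(q+1)\right)^2-g\left(\sharp X(\mathbb{F}_{q^2})-(q^2+1)\right)$. *)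

theory Defs
  imports
    "HOL-Analysis.Cartesian_Space"
    "HOL-Library.Poly_Mapping"
    "HOL-Library.Extended_Nat"
    "HOL-Algebra.Algebraic_Closure_Type"
    "HOL-Computational_Algebra.Polynomial_FPS"
    "HOL.Complex"
begin

section \<open>Polynomials in finitely many variables\<close>

text \<open>
  The variables are indexed by a finite type \<open>'n\<close>; a monomial is its exponent vector.
  With \<open>CARD('n) = N + 1\<close> these are the polynomials in the homogeneous coordinates of
  projective \<open>N\<close>-space.
\<close>

type_synonym ('n, 'k) mvpoly = "('n \<Rightarrow>\<^sub>0 nat) \<Rightarrow>\<^sub>0 'k"

definition mv_eval :: "('n::finite, 'k::field) mvpoly \<Rightarrow> 'k ^ 'n \<Rightarrow> 'k" where
  "mv_eval f x = (\<Sum>m \<in> Poly_Mapping.keys f.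
     Poly_Mapping.lookup f m * (\<Prod>i\<in>UNIV. (x $ i) ^ Poly_Mapping.lookup m i))"

text \<open>The gradient: its \<open>i\<close>-th entry is the formal partial derivative by \<open>X\<^sub>i\<close>, evaluated at \<open>x\<close>.\<close>

definition mv_grad :: "('n::finite, 'k::field) mvpoly \<Rightarrow> 'k ^ 'n \<Rightarrow> 'k ^ 'n" where
  "mv_grad f x = (\<chi> i. \<Sum>m \<in> Poly_Mapping.keys f.
     Poly_Mapping.lookup f m * of_nat (Poly_Mapping.lookup m i)
       * (x $ i) ^ (Poly_Mapping.lookup m i - 1)
       * (\<Prod>j\<in>UNIV - {i}. (x $ j) ^ Poly_Mapping.lookup m j))"

definition form :: "nat \<Rightarrow> ('n::finite, 'k::field) mvpoly \<Rightarrow> bool" where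
  "form d f \<longleftrightarrow> (\<forall>m \<in> Poly_Mapping.keys f. (\<Sum>i\<in>UNIV. Poly_Mapping.lookup m i) = d)"

definition mv_scale :: "'k::field \<Rightarrow> ('n::finite, 'k) mvpoly \<Rightarrow> ('n, 'k) mvpoly" where
  "mv_scale c f = Poly_Mapping.single 0 c * f"

interpretation mv: vector_space "mv_scale :: 'k::field \<Rightarrow> ('n::finite, 'k) mvpoly \<Rightarrow> _"
  by unfold_locales
     (simp_all add: mv_scale_def algebra_simps single_add mult_single flip: mult.assoc)

section \<open>Projective algebraic sets\<close>

text \<open>A point of projective space is a line \<open>vec.span {x}\<close> with \<open>x \<noteq> 0\<close>.\<close>

type_synonym ('k, 'n) proj_set = "('k ^ 'n) set set"

definition proj_zeros :: "('n::finite, 'k::field) mvpoly set \<Rightarrow> ('k, 'n) proj_set" where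
  "proj_zeros S = {vec.span {x} | x. x \<noteq> 0 \<and> (\<forall>f\<in>S. mv_eval f x = 0)}"

definition zariski_closed :: "('k::field, 'n::finite) proj_set \<Rightarrow> bool" where
  "zariski_closed Z \<longleftrightarrow> (\<exists>S. (\<forall>f\<in>S. \<exists>d. form d f) \<and> Z = proj_zeros S)"

definition zariski_irreducible :: "('k::field, 'n::finite) proj_set \<Rightarrow> bool" where
  "zariski_irreducible Z \<longleftrightarrow> Z \<noteq> {} \<and>
     (\<forall>A B. zariski_closed A \<longrightarrow> zariski_closed B \<longrightarrow> Z \<subseteq> A \<union> B \<longrightarrow> Z \<subseteq> A \<or> Z \<subseteq> B)"

text \<open>Krull dimension of a closed set.\<close>

definition zariski_dim :: "('k::field, 'n::finite) proj_set \<Rightarrow> enat" where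
  "zariski_dim Z = Sup {enat n | n W.
     (\<forall>i\<le>n. zariski_closed (W i) \<and> zariski_irreducible (W i) \<and> W i \<subseteq> Z) \<and>
     (\<forall>i<n. W i \<subset> W (Suc i))}"

text \<open>The degree \<open>d\<close> part of the homogeneous ideal of \<open>Z\<close>.\<close>

definition vanishing_forms :: "('k::field, 'n::finite) proj_set \<Rightarrow> nat \<Rightarrow> ('n, 'k) mvpoly set" where
  "vanishing_forms Z d =
     {f. form d f \<and> (\<forall>x. x \<noteq> 0 \<longrightarrow> vec.span {x} \<in> Z \<longrightarrow> mv_eval f x = 0)}"

text \<open>
  Jacobian criterion: for \<open>Z\<close> of dimension \<open>r\<close> in projective \<open>N\<close>-space, \<open>N = CARD('n) - 1\<close>,
  the gradients of the forms in the ideal of \<open>Z\<close> span a space of dimension \<open>N - r\<close> at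
  every point. This is meant for irreducible \<open>Z\<close> over an algebraically closed field.
\<close>

definition smooth_proj :: "('k::field, 'n::finite) proj_set \<Rightarrow> bool" where
  "smooth_proj Z \<longleftrightarrow> (\<forall>x. x \<noteq> 0 \<longrightarrow> vec.span {x} \<in> Z \<longrightarrow>
     enat (vec.dim {mv_grad f x | f d. f \<in> vanishing_forms Z d}) + zariski_dim Z + 1
       = enat CARD('n))"

text \<open>The Hilbert function: dimension of the degree \<open>d\<close> part of the homogeneous coordinate ring.\<close>

definition hilbert_fun :: "('k::field, 'n::finite) proj_set \<Rightarrow> nat \<Rightarrow> int" where
  "hilbert_fun Z d =
     int (mv.dim {f :: ('n, 'k) mvpoly. form d f}) - int (mv.dim (vanishing_forms Z d))"

section \<open>Curves over a finite field\<close>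

text \<open>
  The field with \<open>q\<close> elements is the type \<open>'a\<close>, \<open>q = CARD('a)\<close>. A curve is given by its
  points over the algebraic closure. Since finite fields are perfect, this set together
  with the embedding in projective space determines the (reduced) curve over \<open>'a\<close>.
\<close>

definition defined_over_base ::
    "('a::{field,finite} alg_closure, 'n::finite) proj_set \<Rightarrow> bool" where
  "defined_over_base C \<longleftrightarrow> (\<exists>S :: ('n, 'a) mvpoly set.
     (\<forall>f\<in>S. \<exists>d. form d f) \<and> C = proj_zeros (Poly_Mapping.map to_ac ` S))"

definition curve :: "('a::{field,finite} alg_closure, 'n::finite) proj_set \<Rightarrow> bool" where
  "curve C \<longleftrightarrow> defined_over_base C \<and> zariski_irreducible C \<and> zariski_dim C = 1 \<and> smooth_proj C"

text \<open>
  The genus is read off the Hilbert polynomial \<open>d m + 1 - g\<close>, that is, it is the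
  arithmetic genus, which for a smooth curve is the same as the geometric genus.
\<close>

definition genus :: "('a::{field,finite} alg_closure, 'n::finite) proj_set \<Rightarrow> nat" where
  "genus C = (THE g. \<exists>d. \<forall>\<^sub>F m in sequentially. hilbert_fun C m = d * int m + 1 - int g)"

text \<open>The extension of degree \<open>n\<close> of the field \<open>'a\<close>, for \<open>n \<ge> 1\<close>.\<close>

definition base_ext :: "nat \<Rightarrow> 'a::{field,finite} alg_closure set" where
  "base_ext n = {c. c ^ (CARD('a) ^ n) = c}"

definition rational_points ::
    "('a::{field,finite} alg_closure, 'n::finite) proj_set \<Rightarrow> nat
      \<Rightarrow> ('a alg_closure, 'n) proj_set" where
  "rational_points C n = {vec.span {x} | x. x \<noteq> 0 \<and> (\<forall>i. x $ i \<in> base_ext n)} \<inter> C"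

definition num_points :: "('a::{field,finite} alg_closure, 'n::finite) proj_set \<Rightarrow> nat \<Rightarrow> nat" where
  "num_points C n = card (rational_points C n)"

definition zeta :: "('a::{field,finite} alg_closure, 'n::finite) proj_set \<Rightarrow> complex fps" where
  "zeta C = fps_exp 1 oo
     Abs_fps (\<lambda>n. if n = 0 then 0 else of_nat (num_points C n) / of_nat n)"

text \<open>The numerator of the zeta function, a priori a power series.\<close>

definition L_fun :: "('a::{field,finite} alg_closure, 'n::finite) proj_set \<Rightarrow> complex fps" where
  "L_fun C = zeta C * (1 - fps_X) * (1 - fps_const (of_nat CARD('a)) * fps_X)"

text \<open>
  \<open>\<omega> 1, \<dots>, \<omega> g\<close> is a choice of one Frobenius eigenvalue from each conjugate pair,
  where \<open>g\<close> is the genus. Such an \<open>\<omega>\<close> exists for every curve by the theorem of Hasse and Weil.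
\<close>

definition frobenius_eigenvalues ::
    "('a::{field,finite} alg_closure, 'n::finite) proj_set \<Rightarrow> (nat \<Rightarrow> complex) \<Rightarrow> bool" where
  "frobenius_eigenvalues C \<omega> \<longleftrightarrow>
     L_fun C = fps_of_poly (\<Prod>j=1..genus C. [:1, - \<omega> j:] * [:1, - cnj (\<omega> j):]) \<and>
     (\<forall>j\<in>{1..genus C}. cmod (\<omega> j) = sqrt (real CARD('a)))"

definition HP_defect :: "('a::{field,finite} alg_closure, 'n::finite) proj_set \<Rightarrow> int" where
  "HP_defect C = (let q = int CARD('a); g = int (genus C) in
     2 * q * g\<^sup>2 - (int (num_points C 1) - (q + 1))\<^sup>2 - g * (int (num_points C 2) - (q\<^sup>2 + 1)))"

end

theory Submission
  imports Defs
begin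

text \<open>
  For a power series \<open>f\<close> with constant term \<open>1\<close> the quantities \<open>- f\<^sub>1\<close> and \<open>f\<^sub>1\<^sup>2 - 2 f\<^sub>2\<close> are,
  by Newton's identities, the first two power sums of the reciprocal roots, so both turn products
  into sums. Evaluating them on the two descriptions of the \<open>L\<close>-function expresses the point
  counts over the extensions of degree 1 and 2 by the real numbers \<open>\<omega>\<^sub>j + cnj \<omega>\<^sub>j = 2 \<alpha>\<^sub>j\<close> and
  \<open>\<omega>\<^sub>j\<^sup>2 + cnj \<omega>\<^sub>j\<^sup>2 = 4 \<alpha>\<^sub>j\<^sup>2 - 2 q\<close>.
\<close>

definition fps_psum2 :: "'a::comm_ring_1 fps \<Rightarrow> 'a" where
  "fps_psum2 f = (f $ 1)\<^sup>2 - 2 * f $ 2"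

lemma fps_mult_nth_2:
  fixes f h :: "'a::comm_ring_1 fps"
  shows "(f * h) $ 2 = f $ 0 * h $ 2 + f $ 1 * h $ 1 + f $ 2 * h $ 0"
  by (simp add: fps_mult_nth numeral_2_eq_2)

text \<open>The cross term \<open>f $ 1 * h $ 1\<close> enters the square of the linear coefficient
  twice and the quadratic coefficient once, so it cancels.\<close>

lemma fps_psum2_mult:
  fixes f h :: "'a::comm_ring_1 fps"
  assumes "f $ 0 = 1" and "h $ 0 = 1"
  shows "fps_psum2 (f * h) = fps_psum2 f + fps_psum2 h"
  using assms
  by (simp add: fps_psum2_def fps_mult_nth_2 fps_mult_nth_1 power2_eq_square algebra_simps)

text \<open>The constant term is carried along because the induction step needs it to apply
  \<open>fps_psum2_mult\<close>.\<close>

lemma fps_prod_nth_1_psum2: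
  fixes f :: "'b \<Rightarrow> 'a::comm_ring_1 fps"
  assumes "finite A" and "\<And>j. j \<in> A \<Longrightarrow> f j $ 0 = 1"
  shows "(\<Prod>j\<in>A. f j) $ 0 = 1 \<and> (\<Prod>j\<in>A. f j) $ 1 = (\<Sum>j\<in>A. f j $ 1)
    \<and> fps_psum2 (\<Prod>j\<in>A. f j) = (\<Sum>j\<in>A. fps_psum2 (f j))"
  using assms
proof (induction A rule: finite_induct)
  case empty
  show ?case by (simp add: fps_psum2_def)
next
  case (insert x A)
  then show ?case by (simp add: fps_psum2_mult fps_mult_nth_1)
qed

text \<open>With N1, N2 the point counts, the exponential of N1 T + N2 T^2/2 + ... has quadratic
  coefficient (N1^2 + N2)/2, so the squares of N1 cancel in \<open>fps_psum2\<close>.\<close>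

lemma zeta_coeffs:
  shows "zeta C $ 0 = 1" and "zeta C $ 1 = of_nat (num_points C 1)"
    and "fps_psum2 (zeta C) = - of_nat (num_points C 2)"
  by (simp_all add: zeta_def fps_compose_nth fps_psum2_def fps_mult_nth numeral_2_eq_2
      field_simps)

lemma L_fun_coeffs:
  fixes C :: "('a::{field,finite} alg_closure, 'n::finite) proj_set"
  shows "L_fun C $ 1 = of_nat (num_points C 1) - 1 - of_nat CARD('a)"
    and "fps_psum2 (L_fun C) = 1 + (of_nat CARD('a))\<^sup>2 - of_nat (num_points C 2)"
proof -
  let ?q = "of_nat CARD('a) :: complex"
  have lin: "fps_psum2 (1 - fps_const c * fps_X) = c\<^sup>2" for c :: complex
    by (simp add: fps_psum2_def)
  show "L_fun C $ 1 = of_nat (num_points C 1) - 1 - ?q"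
    by (simp add: L_fun_def fps_mult_nth_1 zeta_coeffs [unfolded One_nat_def])
  show "fps_psum2 (L_fun C) = 1 + ?q\<^sup>2 - of_nat (num_points C 2)"
    unfolding L_fun_def
    \<comment> \<open>The factor \<open>1 - fps_X\<close> carries no explicit constant, hence the
      separate instance c = 1.\<close>
    using lin [of 1] by (simp add: fps_psum2_mult zeta_coeffs lin)
qed

text \<open>The left side is 2 Re(z^2) = 2 (x^2 - y^2) for z = x + iy, and y^2 is eliminated by x^2
  + y^2 = |z|^2.\<close>

lemma power2_add_cnj_power2: "z\<^sup>2 + (cnj z)\<^sup>2 = of_real (4 * (Re z)\<^sup>2 - 2 * (cmod z)\<^sup>2)"
  by (simp add: complex_eq_iff cmod_power2 Re_power2 Im_power2)

lemma
  fixes C :: "('a::{field,finite} alg_closure, 'n::finite) proj_set"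
  assumes "frobenius_eigenvalues C \<omega>"
  shows num_points_1: "real (num_points C 1)
      = 1 + real CARD('a) - 2 * (\<Sum>j=1..genus C. Re (\<omega> j))"
    and num_points_2: "real (num_points C 2)
      = 1 + (real CARD('a))\<^sup>2 + 2 * real CARD('a) * real (genus C)
        - 4 * (\<Sum>j=1..genus C. (Re (\<omega> j))\<^sup>2)"
proof -
  \<comment> \<open>Keeping each conjugate pair in one factor makes both invariants of the factor
    real, so the complex identities below descend to the reals.\<close>
  define F where "F j = fps_of_poly ([:1, - \<omega> j:] * [:1, - cnj (\<omega> j):])" for j
  have L: "L_fun C = (\<Prod>j=1..genus C. F j)"
    and norm: "\<And>j. j \<in> {1..genus C} \<Longrightarrow> (cmod (\<omega> j))\<^sup>2 = real CARD('a)"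
    using assms by (simp_all add: frobenius_eigenvalues_def F_def fps_of_poly_prod)
  have F0: "F j $ 0 = 1" for j
    by (simp add: F_def)
  have F1: "F j $ 1 = of_real (- 2 * Re (\<omega> j))" for j
    by (simp add: F_def complex_eq_iff)
  have F2: "fps_psum2 (F j) = (\<omega> j)\<^sup>2 + (cnj (\<omega> j))\<^sup>2" for j
    by (simp add: F_def fps_psum2_def numeral_2_eq_2 power2_eq_square algebra_simps)
  note prod = fps_prod_nth_1_psum2 [of "{1..genus C}" F, OF finite_atLeastAtMost F0]
  have "complex_of_real (real (num_points C 1) - 1 - real CARD('a)) = L_fun C $ 1"
    by (simp add: L_fun_coeffs [unfolded One_nat_def])
  also have "\<dots> = of_real (\<Sum>j=1..genus C. - 2 * Re (\<omega> j))"
    using prod by (simp only: L F1 of_real_sum)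
  finally have "real (num_points C 1) - 1 - real CARD('a) = (\<Sum>j=1..genus C. - 2 * Re (\<omega> j))"
    by (simp only: of_real_eq_iff)
  then show "real (num_points C 1)
      = 1 + real CARD('a) - 2 * (\<Sum>j=1..genus C. Re (\<omega> j))"
    by (simp add: sum_negf flip: sum_distrib_left)
  have "complex_of_real (1 + (real CARD('a))\<^sup>2 - real (num_points C 2)) = fps_psum2 (L_fun C)"
    by (simp add: L_fun_coeffs)
  also have "\<dots> = of_real (\<Sum>j=1..genus C. 4 * (Re (\<omega> j))\<^sup>2 - 2 * (cmod (\<omega> j))\<^sup>2)"
    using prod by (simp only: L F2 power2_add_cnj_power2 of_real_sum)
  finally have "1 + (real CARD('a))\<^sup>2 - real (num_points C 2)
      = (\<Sum>j=1..genus C. 4 * (Re (\<omega> j))\<^sup>2 - 2 * (cmod (\<omega> j))\<^sup>2)"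
    by (simp only: of_real_eq_iff)
  \<comment> \<open>The Hasse-Weil absolute value |\<omega>| = sqrt q enters here.\<close>
  also have "\<dots> = (\<Sum>j=1..genus C. 4 * (Re (\<omega> j))\<^sup>2 - 2 * real CARD('a))"
    using norm by (intro sum.cong) simp_all
  also have "\<dots> = 4 * (\<Sum>j=1..genus C. (Re (\<omega> j))\<^sup>2) - 2 * real CARD('a) * real (genus C)"
    by (simp add: sum_subtractf sum_distrib_left)
  finally show "real (num_points C 2)
      = 1 + (real CARD('a))\<^sup>2 + 2 * real CARD('a) * real (genus C)
        - 4 * (\<Sum>j=1..genus C. (Re (\<omega> j))\<^sup>2)"
    by linarith
qed

text \<open>Induction step for sums over pairs: the new pairs are those with second entry g +
  1.\<close>

lemma sum_pairs_Suc:
  fixes F :: "nat \<times> nat \<Rightarrow> 'a::comm_monoid_add"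
  shows "(\<Sum>p\<in>{(j,k). 1 \<le> j \<and> j < k \<and> k \<le> Suc g}. F p)
    = (\<Sum>p\<in>{(j,k). 1 \<le> j \<and> j < k \<and> k \<le> g}. F p) + (\<Sum>j=1..g. F (j, Suc g))"
proof -
  have fin: "finite {(j,k). 1 \<le> j \<and> j < k \<and> k \<le> g}"
    by (rule finite_subset [of _ "{1..g} \<times> {1..g}"]) auto
  have "{(j,k). 1 \<le> j \<and> j < k \<and> k \<le> Suc g}
      = {(j,k). 1 \<le> j \<and> j < k \<and> k \<le> g} \<union> (\<lambda>j. (j, Suc g)) ` {1..g}"
    by (auto simp: le_Suc_eq)
  moreover have "{(j,k). 1 \<le> j \<and> j < k \<and> k \<le> g} \<inter> (\<lambda>j. (j, Suc g)) ` {1..g} = {}"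
    by auto
  ultimately show ?thesis
    using fin by (simp add: sum.union_disjoint sum.reindex inj_on_def)
qed

lemma square_sum_eq_sum_squares_pairs:
  fixes a :: "nat \<Rightarrow> 'a::comm_ring_1"
  shows "(\<Sum>j=1..g. a j)\<^sup>2 = (\<Sum>j=1..g. (a j)\<^sup>2)
    + 2 * (\<Sum>(j,k)\<in>{(j,k). 1 \<le> j \<and> j < k \<and> k \<le> g}. a j * a k)"
proof (induction g)
  case 0
  have "{(j,k). 1 \<le> j \<and> j < k \<and> k \<le> (0::nat)} = {}" by auto
  then show ?case by (simp only: sum.empty) simp
next
  case (Suc g)
  then show ?case
    unfolding sum_pairs_Suc
    by (simp add: power2_sum algebra_simps flip: sum_distrib_right sum_distrib_left)
qed

text \<open>This is Lagrange's identity for the vector a and the all-ones vector: the gap in the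
  Cauchy-Schwarz inequality.\<close>

lemma sum_square_diff_pairs:
  fixes a :: "nat \<Rightarrow> 'a::comm_ring_1"
  shows "(\<Sum>(j,k)\<in>{(j,k). 1 \<le> j \<and> j < k \<and> k \<le> g}. (a j - a k)\<^sup>2)
    = of_nat g * (\<Sum>j=1..g. (a j)\<^sup>2) - (\<Sum>j=1..g. a j)\<^sup>2"
proof (induction g)
  case 0
  have "{(j,k). 1 \<le> j \<and> j < k \<and> k \<le> (0::nat)} = {}" by auto
  then show ?case by (simp only: sum.empty) simp
next
  case (Suc g)
  have "(\<Sum>j=1..g. (a j - a (Suc g))\<^sup>2)
      = (\<Sum>j=1..g. (a j)\<^sup>2) + of_nat g * (a (Suc g))\<^sup>2 - 2 * (\<Sum>j=1..g. a j) * a (Suc g)"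
    by (simp add: power2_diff sum.distrib sum_subtractf sum_distrib_left sum_distrib_right)
  then show ?case
    unfolding sum_pairs_Suc prod.case Suc by (simp add: power2_sum algebra_simps)
qed

text \<open>This is g^2 times the rule that the variance is the mean of the squares minus the square
  of the mean.\<close>

lemma sum_square_diff_mean:
  fixes a :: "nat \<Rightarrow> real"
  assumes "g \<ge> 1"
  shows "real g * (\<Sum>j=1..g. (a j - (1 / real g) * (\<Sum>j=1..g. a j))\<^sup>2)
    = real g * (\<Sum>j=1..g. (a j)\<^sup>2) - (\<Sum>j=1..g. a j)\<^sup>2"
proof -
  define S where "S = (\<Sum>j=1..g. a j)"
  have sq: "(\<Sum>j=1..g. (a j - m)\<^sup>2) = (\<Sum>j=1..g. (a j)\<^sup>2) + real g * m\<^sup>2 - 2 * S * m" for m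
    by (simp add: S_def power2_diff sum.distrib sum_subtractf sum_distrib_left sum_distrib_right)
  define m where "m = (1 / real g) * S"
  \<comment> \<open>Writing S through the mean m removes the division; a polynomial identity in m
    remains.\<close>
  have S: "S = real g * m"
    using assms by (simp add: m_def)
  have "real g * ((\<Sum>j=1..g. (a j)\<^sup>2) + real g * m\<^sup>2 - 2 * S * m)
      = real g * (\<Sum>j=1..g. (a j)\<^sup>2) - S\<^sup>2"
    unfolding S by (simp add: power2_eq_square algebra_simps flip: sum_distrib_left)
  then show ?thesis
    by (simp only: sq S_def [symmetric] m_def [symmetric])
qed

theorem theorem3p2:
  fixes C :: "('a::{field,finite} alg_closure, 'n::finite) proj_set"
    and g :: nat and \<omega> :: "nat \<Rightarrow> complex" and \<alpha> :: "nat \<Rightarrow> real"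
  assumes "curve C" and "genus C = g" and "g \<ge> 1"
    and "frobenius_eigenvalues C \<omega>"
    and "\<And>j. j \<in> {1..g} \<Longrightarrow> \<alpha> j = Re (\<omega> j)"
  shows
    "real_of_int (HP_defect C)
       = 4 * (real g * (\<Sum>j=1..g. (\<alpha> j)\<^sup>2) - (\<Sum>j=1..g. \<alpha> j)\<^sup>2)
     \<and> (let \<sigma>1 = (\<Sum>j=1..g. \<alpha> j);
            \<sigma>2 = (\<Sum>(j,k)\<in>{(j,k). 1 \<le> j \<and> j < k \<and> k \<le> g}. \<alpha> j * \<alpha> k)
        in real_of_int (HP_defect C) = 4 * ((real g - 1) * \<sigma>1\<^sup>2 - 2 * real g * \<sigma>2))
     \<and> real_of_int (HP_defect C)
       = 4 * (\<Sum>(j,k)\<in>{(j,k). 1 \<le> j \<and> j < k \<and> k \<le> g}. (\<alpha> j - \<alpha> k)\<^sup>2)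
     \<and> (let \<alpha>_mean = (1 / real g) * (\<Sum>j=1..g. \<alpha> j);
            V = (1 / real g) * (\<Sum>j=1..g. (\<alpha> j - \<alpha>_mean)\<^sup>2)
        in real_of_int (HP_defect C) = 4 * (real g)\<^sup>2 * V)"
proof -
  define S1 where "S1 = (\<Sum>j=1..g. \<alpha> j)"
  define S2 where "S2 = (\<Sum>j=1..g. (\<alpha> j)\<^sup>2)"
  have sums: "(\<Sum>j=1..genus C. Re (\<omega> j)) = S1" "(\<Sum>j=1..genus C. (Re (\<omega> j))\<^sup>2) = S2"
    using assms(2,5) by (simp_all add: S1_def S2_def)
  note N = num_points_1 [OF assms(4), unfolded sums] num_points_2 [OF assms(4), unfolded sums]
  have i: "real_of_int (HP_defect C) = 4 * (real g * S2 - S1\<^sup>2)"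
  proof -
    have "real_of_int (HP_defect C) = 2 * real CARD('a) * (real g)\<^sup>2
        - (real (num_points C 1) - (real CARD('a) + 1))\<^sup>2
        - real g * (real (num_points C 2) - ((real CARD('a))\<^sup>2 + 1))"
      using assms(2) by (simp add: HP_defect_def Let_def)
    \<comment> \<open>The differences are N1 - (q + 1) = -2 \<open>S1\<close> and N2 - (q^2 + 1) =
      2qg - 4 \<open>S2\<close>, so the terms 2qg^2 cancel.\<close>
    then show ?thesis
      unfolding N assms(2) by (simp add: power2_eq_square algebra_simps)
  qed
  have ii: "real g * S2 - S1\<^sup>2 = (real g - 1) * S1\<^sup>2
      - 2 * real g * (\<Sum>(j,k)\<in>{(j,k). 1 \<le> j \<and> j < k \<and> k \<le> g}. \<alpha> j * \<alpha> k)"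
    using square_sum_eq_sum_squares_pairs [of \<alpha> g, folded S1_def S2_def]
    by (simp add: algebra_simps)
  have iii: "(\<Sum>(j,k)\<in>{(j,k). 1 \<le> j \<and> j < k \<and> k \<le> g}. (\<alpha> j - \<alpha> k)\<^sup>2) = real g * S2 - S1\<^sup>2"
    using sum_square_diff_pairs [of \<alpha> g] by (simp add: S1_def S2_def)
  have iv: "(real g)\<^sup>2 * ((1 / real g) * (\<Sum>j=1..g. (\<alpha> j - (1 / real g) * S1)\<^sup>2))
      = real g * S2 - S1\<^sup>2"
    using sum_square_diff_mean [OF assms(3), of \<alpha>, folded S1_def S2_def] assms(3)
    by (simp add: power2_eq_square)
  show ?thesis
    \<comment> \<open>Reassociating the factor 4 exposes the left side of \<open>iv\<close>.\<close>
    unfolding Let_def S1_def [symmetric] S2_def [symmetric] mult.assoc [of 4 "(real g)\<^sup>2"] iii iv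
    by (simp only: i ii)
qed

end
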